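(* Let $\mathbb{V}$ be a finite dimensional real inner product space, $Q, H\in\mathbb{V}$ with $H\neq O$, and let $\mathbb{K}\subseteq\mathbb{V}$ be a nonempty cone. Assume that $\mathcal{F} \subseteq \widehat{\mathcal{F}}(\mathbb{K})$ and that $-\infty < \zeta_p\big(\mathrm{co}(\bigcup \mathcal{F})\big) < \infty$. Then the following assertions hold. (i) $\zeta_p\big(\bigcup(\mathbb{K}\cap\mathcal{F})\big)= \zeta_p\big(\mathbb{K}\cap\mathrm{co}(\bigcup \mathcal{F})\big) =\zeta_p\big(\mathrm{co}(\bigcup \mathcal{F})\big)$. (ii) $\zeta_p(\mathbb{K}\cap\mathbb{F})=\zeta_p(\mathbb{F})$ for every $\mathbb{F} \in \mathcal{F}$. (iii) $\zeta_p\big(\mathbb{K}\cap\mathrm{co}(\bigcup \mathcal{F})\big) = \inf\{\zeta_p(\mathbb{K}\cap\mathbb{F}): \mathbb{F}\in\mathcal{F}\} = \inf\{\zeta_p(\mathbb{F}): \mathbb{F}\in\mathcal{F}\}$.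
   Context: A set $\mathbb{C}\subseteq\mathbb{V}$ is a cone (not necessarily convex nor closed) if $\lambda A\in\mathbb{C}$ for every $A\in\mathbb{C}$ and $\lambda\ge 0$. $\mathrm{co}$ denotes the convex hull. $\widehat{\mathcal{F}}(\mathbb{K})$ is the family of all convex cones $\mathbb{J}\subseteq\mathrm{co}\,\mathbb{K}$ satisfying $\mathrm{co}(\mathbb{K}\cap\mathbb{J})=\mathbb{J}$. For a family $\mathcal{F}$ of subsets of $\mathbb{V}$, $\bigcup\mathcal{F}=\bigcup_{U\in\mathcal{F}}U$ and $\mathbb{K}\cap\mathcal{F}=\{\mathbb{K}\cap U:U\in\mathcal{F}\}$. For a cone $\mathbb{C}\subseteq\mathbb{V}$, $\zeta_p(\mathbb{C})=\inf\{\langle Q,X\rangle : X\in\mathbb{C},\ \langle H,X\rangle=1\}$, with $\zeta_p(\mathbb{C})=\infty$ if the feasible set is empty. *)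

theory Defs
  imports "HOL-Analysis.Analysis"
begin

text \<open>The infimum is taken in \<^typ>\<open>ereal\<close>, so it is \<open>\<infinity>\<close> when no feasible point exists
  and \<open>-\<infinity>\<close> when the objective is unbounded below.\<close>

definition zeta_p :: "'a::euclidean_space \<Rightarrow> 'a \<Rightarrow> 'a set \<Rightarrow> ereal" where
  "zeta_p Q H C = (INF X \<in> {X \<in> C. H \<bullet> X = 1}. ereal (Q \<bullet> X))"

text \<open>\<^const>\<open>cone\<close> requires closure under nonnegative scaling only: no convexity, closedness or
  nonemptiness. In particular the empty set belongs to \<open>F_hat K\<close>.\<close>

definition F_hat :: "'a::euclidean_space set \<Rightarrow> 'a set set" where
  "F_hat K = {J. cone J \<and> convex J \<and> J \<subseteq> convex hull K \<and> convex hull (K \<inter> J) = J}"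

end

theory Submission
  imports Defs
begin

text \<open>
  Everything rests on one fact, \<open>zeta_p_convex_hull\<close>: convexifying a cone \<open>C\<close> does not lower the
  optimal value, as long as the convexified problem is bounded below.
  Let \<open>p\<close> be the value over \<open>C\<close>. It suffices that the linear functional \<open>X \<mapsto> (Q - p H) \<bullet> X\<close>
  is nonnegative on \<open>C\<close>, since it is then nonnegative on the convex hull, where \<open>H \<bullet> X = 1\<close>
  gives \<open>Q \<bullet> X \<ge> p\<close>. Points of \<open>C\<close> with \<open>H \<bullet> X > 0\<close> can be rescaled to feasible ones, so
  for them the inequality is the definition of \<open>p\<close>. The other points are where boundedness over
  the convex hull enters: adding to such an \<open>X\<close> a suitable multiple of a feasible \<open>Y\<close> gives a
  direction in \<open>convex hull C\<close> with \<open>H\<close>-value \<open>0\<close>, along which \<open>Q\<close> cannot decrease.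

  Given this fact, (ii) is its instance \<open>C = K \<inter> F\<close>, whose hull is \<open>F\<close>. For (i), the union of the
  sets \<open>K \<inter> F\<close> is a cone whose hull is that of \<open>\<Union>\<F>\<close>, and \<open>K \<inter> convex hull (\<Union>\<F>)\<close> lies
  between the two. Finally (iii) holds because the value over a union is the infimum of the values.
\<close>

lemma zeta_p_antimono: "C \<subseteq> D \<Longrightarrow> zeta_p Q H D \<le> zeta_p Q H C"
  unfolding zeta_p_def by (intro INF_superset_mono) auto

lemma zeta_p_le: "X \<in> C \<Longrightarrow> H \<bullet> X = 1 \<Longrightarrow> zeta_p Q H C \<le> ereal (Q \<bullet> X)"
  unfolding zeta_p_def by (intro INF_lower) auto

lemma zeta_p_greatest:
  "(\<And>X. X \<in> C \<Longrightarrow> H \<bullet> X = 1 \<Longrightarrow> z \<le> ereal (Q \<bullet> X)) \<Longrightarrow> z \<le> zeta_p Q H C"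
  unfolding zeta_p_def by (intro INF_greatest) auto

lemma zeta_p_UN: "zeta_p Q H (\<Union>i\<in>I. C i) = (INF i\<in>I. zeta_p Q H (C i))"
proof (rule antisym)
  show "zeta_p Q H (\<Union>i\<in>I. C i) \<le> (INF i\<in>I. zeta_p Q H (C i))"
    by (intro INF_greatest zeta_p_antimono) blast
  show "(INF i\<in>I. zeta_p Q H (C i)) \<le> zeta_p Q H (\<Union>i\<in>I. C i)"
    by (intro zeta_p_greatest) (meson INF_lower2 UN_E zeta_p_le)
qed

lemma convex_cone_add_scaled:
  assumes "cone D" "convex D" "X \<in> D" "Y \<in> D" "c \<ge> 0"
  shows "X + c *\<^sub>R Y \<in> D"
proof -
  have "convex_cone D"
    using assms by (auto simp: convex_cone_def conic_def cone_def)
  moreover have "c *\<^sub>R Y \<in> D"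
    using assms by (simp add: mem_cone)
  ultimately show ?thesis
    using assms by (intro convex_cone_add)
qed

text \<open>If \<open>Q\<close> decreased along such a direction \<open>W\<close>, the feasible ray \<open>Y + s *\<^sub>R W\<close> would make the
  value \<open>-\<infinity>\<close>.\<close>

lemma recession_direction_nonneg:
  assumes D: "cone D" "convex D" and bdd: "-\<infinity> < zeta_p Q H D"
    and Y: "Y \<in> D" "H \<bullet> Y = 1" and W: "W \<in> D" "H \<bullet> W = 0"
  shows "Q \<bullet> W \<ge> 0"
proof (rule ccontr)
  assume "\<not> Q \<bullet> W \<ge> 0"
  hence neg: "Q \<bullet> W < 0" by simp
  obtain z where z: "zeta_p Q H D = ereal z"
    using bdd zeta_p_le[OF Y, of Q] by (cases "zeta_p Q H D") auto
  have bound: "z \<le> Q \<bullet> Y + s * (Q \<bullet> W)" if "s \<ge> 0" for s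
  proof -
    have "zeta_p Q H D \<le> ereal (Q \<bullet> (Y + s *\<^sub>R W))"
      using Y W that by (intro zeta_p_le convex_cone_add_scaled D) (auto simp: inner_add_right)
    thus ?thesis using z by (simp add: inner_add_right)
  qed
  \<comment> \<open>This step length makes the objective on the ray equal to \<open>z - 1\<close>.\<close>
  define s where "s = (Q \<bullet> Y - z + 1) / - (Q \<bullet> W)"
  have "s \<ge> 0" using bound[of 0] neg unfolding s_def by (intro divide_nonneg_pos) auto
  moreover have "s * (Q \<bullet> W) = z - 1 - Q \<bullet> Y"
    using neg unfolding s_def by (simp add: field_simps)
  ultimately show False using bound[of s] by simp
qed

text \<open>Feasibility cannot be created by convexifying a cone: otherwise \<open>C\<close> would lie in the
  half-space \<open>H \<bullet> X \<le> 0\<close>, and so would its hull.\<close>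

lemma cone_feasible_if_hull_feasible:
  assumes C: "cone C" and X: "X \<in> convex hull C" "H \<bullet> X = 1"
  obtains Y where "Y \<in> C" "H \<bullet> Y = 1"
proof -
  have "\<not> C \<subseteq> {X. H \<bullet> X \<le> 0}"
  proof
    assume "C \<subseteq> {X. H \<bullet> X \<le> 0}"
    hence "convex hull C \<subseteq> {X. H \<bullet> X \<le> 0}"
      by (intro hull_minimal convex_halfspace_le)
    thus False using X by auto
  qed
  then obtain Z where Z: "Z \<in> C" "H \<bullet> Z > 0" by force
  hence "(1 / (H \<bullet> Z)) *\<^sub>R Z \<in> C"
    by (intro mem_cone[OF C]) auto
  thus ?thesis using Z by (intro that[of "(1 / (H \<bullet> Z)) *\<^sub>R Z"]) auto
qed

text \<open>The number \<open>p\<close> is a dual certificate: it is feasible for the Lagrangian dual of the problem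
  over \<open>C\<close>, although \<open>C\<close> need not be convex.\<close>

lemma value_is_dual_feasible:
  assumes C: "cone C" and bdd: "-\<infinity> < zeta_p Q H (convex hull C)"
    and p: "zeta_p Q H C = ereal p" and Y: "Y \<in> C" "H \<bullet> Y = 1" and X: "X \<in> C"
  shows "p * (H \<bullet> X) \<le> Q \<bullet> X"
proof (cases "H \<bullet> X > 0")
  case True
  have "(1 / (H \<bullet> X)) *\<^sub>R X \<in> C"
    using True by (intro mem_cone[OF C X]) auto
  hence "zeta_p Q H C \<le> ereal (Q \<bullet> ((1 / (H \<bullet> X)) *\<^sub>R X))"
    using True by (intro zeta_p_le) auto
  hence "p \<le> (Q \<bullet> X) / (H \<bullet> X)" using p by simp
  thus ?thesis using True by (simp add: field_simps)
next
  case False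
  let ?D = "convex hull C"
  have D: "cone ?D" "convex ?D" "C \<subseteq> ?D"
    using C by (auto simp: cone_convex_hull hull_subset)
  have pair: "(H \<bullet> X) * (Q \<bullet> Z) \<le> Q \<bullet> X" if Z: "Z \<in> C" "H \<bullet> Z = 1" for Z
  proof -
    have "X + (- (H \<bullet> X)) *\<^sub>R Z \<in> ?D"
      using X Z D False by (intro convex_cone_add_scaled) auto
    hence "Q \<bullet> (X + (- (H \<bullet> X)) *\<^sub>R Z) \<ge> 0"
      using Z D bdd by (intro recession_direction_nonneg[where D = ?D and Y = Z])
        (auto simp: inner_diff_right)
    thus ?thesis by (simp add: inner_diff_right)
  qed
  show ?thesis
  proof (cases "H \<bullet> X = 0")
    case True
    thus ?thesis using pair[OF Y] by simp
  next
    case nonzero: False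
    have neg: "H \<bullet> X < 0" using False nonzero by simp
    have "ereal ((Q \<bullet> X) / (H \<bullet> X)) \<le> zeta_p Q H C"
    proof (rule zeta_p_greatest)
      fix Z assume "Z \<in> C" "H \<bullet> Z = 1"
      from pair[OF this] show "ereal ((Q \<bullet> X) / (H \<bullet> X)) \<le> ereal (Q \<bullet> Z)"
        using neg by (simp add: neg_divide_le_eq mult.commute)
    qed
    thus ?thesis using p neg by (simp add: neg_divide_le_eq)
  qed
qed

text \<open>Boundedness over the hull is essential. In the plane with \<open>H \<bullet> (x, y) = x\<close> and
  \<open>Q \<bullet> (x, y) = y\<close>, let \<open>C\<close> be the union of the rays spanned by \<open>(1, 0)\<close> and \<open>(-1, -1)\<close>. Its only
  feasible point is \<open>(1, 0)\<close>, so the value is \<open>0\<close>, but the hull contains the direction \<open>(0, -1)\<close>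
  and has value \<open>-\<infinity>\<close>.\<close>

lemma zeta_p_convex_hull:
  assumes C: "cone C" and bdd: "-\<infinity> < zeta_p Q H (convex hull C)"
  shows "zeta_p Q H (convex hull C) = zeta_p Q H C"
proof (rule antisym)
  show mono: "zeta_p Q H (convex hull C) \<le> zeta_p Q H C"
    by (intro zeta_p_antimono hull_subset)
  show "zeta_p Q H C \<le> zeta_p Q H (convex hull C)"
  proof (rule zeta_p_greatest)
    fix X assume X: "X \<in> convex hull C" "H \<bullet> X = 1"
    then obtain Y where Y: "Y \<in> C" "H \<bullet> Y = 1"
      using cone_feasible_if_hull_feasible[OF C] by blast
    obtain p where p: "zeta_p Q H C = ereal p"
      using mono bdd zeta_p_le[OF Y, of Q] by (cases "zeta_p Q H C") auto
    have "C \<subseteq> {X. (Q - p *\<^sub>R H) \<bullet> X \<ge> 0}"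
      using value_is_dual_feasible[OF C bdd p Y] by (auto simp: inner_diff_left)
    hence "convex hull C \<subseteq> {X. (Q - p *\<^sub>R H) \<bullet> X \<ge> 0}"
      by (intro hull_minimal convex_halfspace_ge)
    hence "p \<le> Q \<bullet> X" using X by (auto simp: inner_diff_left)
    thus "zeta_p Q H C \<le> ereal (Q \<bullet> X)" using p by simp
  qed
qed

lemma convex_hull_UN_slices:
  assumes "\<F> \<subseteq> F_hat K"
  shows "convex hull (\<Union>F\<in>\<F>. K \<inter> F) = convex hull (\<Union>\<F>)"
proof (rule antisym)
  show "convex hull (\<Union>F\<in>\<F>. K \<inter> F) \<subseteq> convex hull (\<Union>\<F>)"
    by (intro hull_mono) auto
  have "F \<subseteq> convex hull (\<Union>F\<in>\<F>. K \<inter> F)" if "F \<in> \<F>" for F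
  proof -
    have "F = convex hull (K \<inter> F)"
      using assms that by (auto simp: F_hat_def)
    also have "\<dots> \<subseteq> convex hull (\<Union>F\<in>\<F>. K \<inter> F)"
      using that by (intro hull_mono) auto
    finally show ?thesis .
  qed
  thus "convex hull (\<Union>\<F>) \<subseteq> convex hull (\<Union>F\<in>\<F>. K \<inter> F)"
    by (intro hull_minimal) auto
qed

theorem theorem3p6:
  fixes Q H :: "'a::euclidean_space" and K :: "'a set" and \<F> :: "'a set set"
  assumes "H \<noteq> 0"
    and "K \<noteq> {}" and "cone K"
    and "\<F> \<subseteq> F_hat K"
    and "-\<infinity> < zeta_p Q H (convex hull (\<Union>\<F>))"
    and "zeta_p Q H (convex hull (\<Union>\<F>)) < \<infinity>"
  shows "(zeta_p Q H (\<Union>((\<inter>) K ` \<F>)) = zeta_p Q H (K \<inter> convex hull (\<Union>\<F>)) \<and>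
          zeta_p Q H (K \<inter> convex hull (\<Union>\<F>)) = zeta_p Q H (convex hull (\<Union>\<F>))) \<and>
         (\<forall>F\<in>\<F>. zeta_p Q H (K \<inter> F) = zeta_p Q H F) \<and>
         (zeta_p Q H (K \<inter> convex hull (\<Union>\<F>)) = (INF F\<in>\<F>. zeta_p Q H (K \<inter> F)) \<and>
          (INF F\<in>\<F>. zeta_p Q H (K \<inter> F)) = (INF F\<in>\<F>. zeta_p Q H F))"
proof -
  let ?U = "\<Union>F\<in>\<F>. K \<inter> F" and ?D = "convex hull (\<Union>\<F>)"
  have coneF: "cone F" and hullF: "convex hull (K \<inter> F) = F" if "F \<in> \<F>" for F
    using assms(4) that by (auto simp: F_hat_def)
  have cone_slice: "cone (K \<inter> F)" if "F \<in> \<F>" for F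
    using assms(3) coneF[OF that] unfolding cone_def by blast
  have hullU: "convex hull ?U = ?D"
    using assms(4) by (rule convex_hull_UN_slices)
  have coneU: "cone ?U"
    using cone_slice unfolding cone_def by blast
  have U_D: "zeta_p Q H ?U = zeta_p Q H ?D"
    using zeta_p_convex_hull[OF coneU, of Q H] assms(5) unfolding hullU by simp

  have "?U \<subseteq> K \<inter> ?D"
    using hull_subset[of "\<Union>\<F>" convex] by blast
  hence KD_U: "zeta_p Q H (K \<inter> ?D) \<le> zeta_p Q H ?U"
    by (rule zeta_p_antimono)
  have D_KD: "zeta_p Q H ?D \<le> zeta_p Q H (K \<inter> ?D)"
    by (intro zeta_p_antimono) blast
  have KD: "zeta_p Q H (K \<inter> ?D) = zeta_p Q H ?D"
    using KD_U D_KD U_D by (intro antisym) auto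

  have ii: "zeta_p Q H (K \<inter> F) = zeta_p Q H F" if F: "F \<in> \<F>" for F
  proof -
    have "F \<subseteq> ?D"
      using F hull_subset[of "\<Union>\<F>" convex] by blast
    hence "-\<infinity> < zeta_p Q H F"
      using assms(5) zeta_p_antimono less_le_trans by blast
    thus ?thesis
      using zeta_p_convex_hull[OF cone_slice[OF F], of Q H] by (simp add: hullF[OF F])
  qed

  have iii: "zeta_p Q H (K \<inter> ?D) = (INF F\<in>\<F>. zeta_p Q H (K \<inter> F))"
    using KD U_D unfolding zeta_p_UN by metis
  have "(INF F\<in>\<F>. zeta_p Q H (K \<inter> F)) = (INF F\<in>\<F>. zeta_p Q H F)"
    using ii by (intro INF_cong) auto
  with U_D KD ii iii show ?thesis by auto
qed

end
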